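(* Let $n\ge3$. The map $\varphi$ defined below is a bijection of $\mathrm{And}_{n-1}^{I}$ onto the set $T_n$ of tight Andr\'e I permutations of $\{1,\dots,n\}$, and for every $w\in\mathrm{And}_{n-1}^{I}$: (i) $\mathbf{spi}\,w=\mathbf{F}\,\varphi(w)$; (ii) $\mathbf{grn}\,\varphi(w)=\mathbf{grn}\,w$ if $\mathbf{spi}\,w>\mathbf{grn}\,w$, and $\mathbf{grn}\,\varphi(w)=\mathbf{grn}\,w+1$ if $\mathbf{spi}\,w<\mathbf{grn}\,w$.
   Context: Andr\'e I permutations: words are permutations of finite sets $Y$ of positive integers; the empty word $e$ and one-letter words are Andr\'e I; for $|Y|\ge2$ write $w=v\,\min(w)\,v'$; $w$ is Andr\'e I if $v,v'$ are Andr\'e I and $\max(vv')$ is a letter of $v'$. $\mathrm{And}_n^{I}$: Andr\'e I permutations of $\{1,\dots,n\}$. For $w=x_1\cdots x_n$: $\mathbf{F}\,w=x_1$; $\mathbf{grn}\,w=\max\{x_{i-1},x_{i+1}\}$ where $x_i$ is the maximum letter, with $x_0=x_{n+1}=0$; $\mathbf{spi}\,w$ is the letter $x_i$ such that $x_1\le x_j$ for all $j\le i$ and $x_1>x_{i+1}$ (convention $x_{n+1}=0$). Tight permutations: $w\in\mathrm{And}_n^{I}$ with $\mathbf{F}\,w=m$ is written $w=m\,v\,(m+1)\,v'$; it is tight if (i) either $v=e$ or all letters of $v$ are less than $m$, and (ii) either $v'\ne e$ and the first letter of $v'$ is less than all letters of $w$ to its left, or $v'=e$ (and then $m=n-1$).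 $T_n$ is the set of tight elements of $\mathrm{And}_n^I$. Definition of $\varphi$: for $w=x_1\cdots x_{n-1}\in\mathrm{And}_{n-1}^I$ let $x_j=\mathbf{spi}\,w$; set $\varphi(w)=x_j\,x'_1x'_2\cdots x'_{n-1}$ where $x'_i=x_i$ if $x_i\le x_j-1$ and $x'_i=x_i+1$ if $x_i\ge x_j$. *)

theory Defs
  imports "HOL-Combinatorics.Multiset_Permutations"
begin

definition word :: "nat list \<Rightarrow> bool" where
  "word w \<longleftrightarrow> distinct w \<and> (\<forall>x\<in>set w. 0 < x)"

inductive andreI :: "nat list \<Rightarrow> bool" where
  Nil: "andreI []"
| Single: "0 < x \<Longrightarrow> andreI [x]"
| Step: "\<lbrakk>word w; length w \<ge> 2; w = v @ Min (set w) # v';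
          andreI v; andreI v'; Max (set (v @ v')) \<in> set v'\<rbrakk> \<Longrightarrow> andreI w"

definition And_I :: "nat \<Rightarrow> nat list set" where
  "And_I n = {w \<in> permutations_of_set {1..n}. andreI w}"

text \<open>Letters are numbered from 1, with value 0 at both positions 0 and \<open>length w + 1\<close>.\<close>

definition letter :: "nat list \<Rightarrow> nat \<Rightarrow> nat" where
  "letter w i = (if 1 \<le> i \<and> i \<le> length w then w ! (i - 1) else 0)"

definition F :: "nat list \<Rightarrow> nat" where
  "F w = letter w 1"

definition grn :: "nat list \<Rightarrow> nat" where
  "grn w = (let i = (THE i. i \<in> {1..length w} \<and> letter w i = Max (set w))
            in max (letter w (i - 1)) (letter w (i + 1)))"

definition spi :: "nat list \<Rightarrow> nat" where
  "spi w = letter w (THE i. i \<in> {1..length w} \<and>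
                            (\<forall>j\<in>{1..i}. letter w 1 \<le> letter w j) \<and>
                            letter w 1 > letter w (i + 1))"

text \<open>For a permutation \<open>w \<in> And_I n\<close> the decomposition \<open>m v (m+1) v'\<close> is unique, and \<open>v' = []\<close> forces
  \<open>m = n - 1\<close>, because an Andre I permutation of length at least 2 ends with its maximum letter.\<close>

definition tight :: "nat list \<Rightarrow> bool" where
  "tight w \<longleftrightarrow> (\<exists>m v v'. w = m # v @ (m + 1) # v' \<and>
     (v = [] \<or> (\<forall>x\<in>set v. x < m)) \<and>
     ((v' \<noteq> [] \<and> (\<forall>x\<in>set (m # v @ [m + 1]). hd v' < x)) \<or> v' = []))"

definition Tight :: "nat \<Rightarrow> nat list set" where
  "Tight n = {w \<in> And_I n. tight w}"

definition phi :: "nat list \<Rightarrow> nat list" where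
  "phi w = spi w # map (\<lambda>x. if x < spi w then x else x + 1) w"

end

theory Submission
  imports Defs
begin

text \<open>
  A word is Andr\'e I iff whenever a letter \<open>y\<close> is smaller than all letters of a factor ending just
  before it, the maximal run of letters larger than \<open>y\<close> to the right of \<open>y\<close> contains a letter
  larger than the first letter of that factor. This local condition depends only on the relative
  order of the letters and passes to suffixes, so that prepending \<open>spi w\<close> to \<open>w\<close> only requires
  looking at the factors that start with the new letter; tightness is exactly what makes \<open>spi\<close>
  recover the deleted first letter. Since an Andr\'e I word ends with its maximum, \<open>grn\<close> is the
  penultimate letter.
\<close>

section \<open>Local characterization of Andre I words\<close>

definition valley_dominated :: "nat list \<Rightarrow> bool" where
  "valley_dominated w \<longleftrightarrow> (\<forall>a x b y c. w = a @ x # b @ y # c \<longrightarrow> (\<forall>t\<in>set (x # b). y < t) \<longrightarrow>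
     (\<exists>z\<in>set (takeWhile (\<lambda>t. y < t) c). x < z))"

lemma valley_dominatedD:
  assumes "valley_dominated (a @ x # b @ y # c)" "y < x" "\<forall>t\<in>set b. y < t"
  shows "\<exists>z\<in>set (takeWhile (\<lambda>t. y < t) c). x < z"
  using assms unfolding valley_dominated_def by force

lemma valley_dominated_suffix:
  assumes "valley_dominated (u @ w)"
  shows "valley_dominated w"
  unfolding valley_dominated_def
proof (intro allI impI)
  fix a x b y c
  assume "w = a @ x # b @ y # c" "\<forall>t\<in>set (x # b). y < t"
  then show "\<exists>z\<in>set (takeWhile (\<lambda>t. y < t) c). x < z"
    using valley_dominatedD[of "u @ a" x b y c] assms by auto
qed

text \<open>A pattern with nonempty \<open>a\<close> lies entirely in \<open>w\<close>. The second
  conjunct is the remaining case \<open>a = []\<close>, where the new letter \<open>s\<close> starts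
  the factor.\<close>

lemma valley_dominated_Cons:
  "valley_dominated (s # w) \<longleftrightarrow> valley_dominated w \<and>
     (\<forall>b y c. w = b @ y # c \<longrightarrow> (\<forall>t\<in>set b. y < t) \<longrightarrow> y < s \<longrightarrow>
        (\<exists>z\<in>set (takeWhile (\<lambda>t. y < t) c). s < z))" (is "?L \<longleftrightarrow> _ \<and> ?R")
proof (intro iffI conjI)
  assume ?L
  then show "valley_dominated w" using valley_dominated_suffix[of "[s]" w] by simp
  show ?R using \<open>?L\<close> valley_dominatedD[of "[]" s] by fastforce
next
  assume R: "valley_dominated w \<and> ?R"
  show ?L unfolding valley_dominated_def
  proof (intro allI impI)
    fix a x b y c
    assume *: "s # w = a @ x # b @ y # c" "\<forall>t\<in>set (x # b). y < t"
    show "\<exists>z\<in>set (takeWhile (\<lambda>t. y < t) c). x < z"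
    proof (cases a)
      case Nil
      with * R show ?thesis by auto
    next
      case (Cons a0 a')
      with * have "valley_dominated (a' @ x # b @ y # c)" using R by auto
      then show ?thesis using *(2) valley_dominatedD[of a' x b y c] by auto
    qed
  qed
qed

lemma append_Cons_eq_append_Cons_cases:
  assumes "p @ y # c = v @ m # v'"
  obtains (left) c' where "v = p @ y # c'" "c = c' @ m # v'"
    | (same) "p = v" "y = m" "c = v'"
    | (right) p' where "p = v @ m # p'" "v' = p' @ y # c"
proof -
  from assms consider us where "p = v @ us" "us @ y # c = m # v'" | us where "p @ us = v" "y # c = us @ m # v'"
    unfolding append_eq_append_conv2 by blast
  then show thesis
  proof cases
    case (1 us)
    then show ?thesis using same right by (cases us) auto
  next
    case (2 us)
    then show ?thesis using left same by (cases us) auto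
  qed
qed

lemma takeWhile_append_subset:
  assumes "q = [] \<or> \<not> P (hd q)"
  shows "set (takeWhile P (c @ q)) \<subseteq> set c"
proof -
  have "takeWhile P q = []" using assms by (cases q) auto
  then show ?thesis by (induction c) auto
qed

text \<open>The minimum \<open>m\<close> stops every run of larger letters that starts in
  \<open>v\<close>, so patterns within \<open>v\<close> do not see \<open>v'\<close>. For
  \<open>y = m\<close> the run is all of \<open>v'\<close>, which produces the third condition on
  the right. No pattern has \<open>x\<close> in \<open>v\<close> and \<open>y\<close> in
  \<open>v'\<close>, since \<open>m\<close> would lie between them.\<close>

lemma valley_dominated_split_min:
  assumes min: "\<forall>t\<in>set v \<union> set v'. m < t"
  shows "valley_dominated (v @ m # v') \<longleftrightarrow>
    valley_dominated v \<and> valley_dominated v' \<and> (\<forall>x\<in>set v. \<exists>z\<in>set v'. x < z)" (is "?L \<longleftrightarrow> ?R")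
proof
  assume L: ?L
  have tw': "takeWhile (\<lambda>t. m < t) v' = v'" using min by (simp add: takeWhile_eq_all_conv)
  have "valley_dominated v'" using L valley_dominated_suffix[of "v @ [m]" v'] by simp
  moreover have "valley_dominated v" unfolding valley_dominated_def
  proof (intro allI impI)
    fix a x b y c
    assume *: "v = a @ x # b @ y # c" "\<forall>t\<in>set (x # b). y < t"
    have "takeWhile (\<lambda>t. y < t) (c @ m # v') = takeWhile (\<lambda>t. y < t) c"
      using min *(1) by (simp add: takeWhile_tail)
    then show "\<exists>z\<in>set (takeWhile (\<lambda>t. y < t) c). x < z"
      using valley_dominatedD[of a x b y "c @ m # v'"] * L by auto
  qed
  moreover have "\<exists>z\<in>set v'. x < z" if "x \<in> set v" for x
  proof -
    obtain a b where "v = a @ x # b" using \<open>x \<in> set v\<close> by (meson split_list)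
    then show ?thesis using valley_dominatedD[of a x b m v'] L min tw' by auto
  qed
  ultimately show ?R by blast
next
  assume R: ?R
  show ?L unfolding valley_dominated_def
  proof (intro allI impI)
    fix a x b y c
    assume "v @ m # v' = a @ x # b @ y # c" and gt: "\<forall>t\<in>set (x # b). y < t"
    then have "(a @ x # b) @ y # c = v @ m # v'" by simp
    then show "\<exists>z\<in>set (takeWhile (\<lambda>t. y < t) c). x < z"
    proof (cases rule: append_Cons_eq_append_Cons_cases)
      case (left c')
      have "takeWhile (\<lambda>t. y < t) c = takeWhile (\<lambda>t. y < t) c'"
        using min left by (simp add: takeWhile_tail)
      then show ?thesis using valley_dominatedD[of a x b y c'] R left(1) gt by simp
    next
      case same
      have "takeWhile (\<lambda>t. m < t) v' = v'" using min by (simp add: takeWhile_eq_all_conv)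
      moreover have "x \<in> set v" unfolding same(1)[symmetric] by simp
      ultimately show ?thesis using same(2,3) R by metis
    next
      case (right p')
      \<comment> \<open>The letters of \<open>x # b\<close> exceed \<open>y\<close>, hence
        \<open>m\<close>, so the factor cannot straddle the minimum and begins inside
        \<open>v'\<close>.\<close>
      have "m < y" using min right(2) by simp
      with gt have nm: "m \<notin> set (x # b)" by auto
      from right(1) show ?thesis
      proof (cases rule: append_Cons_eq_append_Cons_cases)
        case (right a')
        then show ?thesis
          using valley_dominatedD[of a' x b y c] R gt \<open>v' = p' @ y # c\<close> by auto
      qed (use nm in auto)
    qed
  qed
qed

text \<open>Both sides decompose at the minimum in the same way: for distinct letters, the maximum
  of \<open>v @ v'\<close> lies in \<open>v'\<close> exactly when each letter of \<open>v\<close> is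
  exceeded by some letter of \<open>v'\<close> (for \<open>v @ v'\<close> nonempty).\<close>

lemma andreI_iff_valley_dominated:
  "andreI w \<longleftrightarrow> word w \<and> valley_dominated w"
proof
  assume "andreI w"
  then show "word w \<and> valley_dominated w"
  proof induction
    case (Step w v v')
    define m where "m = Min (set w)"
    have w: "w = v @ m # v'" unfolding m_def by (fact Step.hyps(3))
    have d: "distinct (v @ m # v')" using Step.hyps(1) unfolding word_def w by blast
    have "m \<le> t" if "t \<in> set v \<union> set v'" for t
      unfolding m_def using that w by (intro Min_le) auto
    then have min: "\<forall>t\<in>set v \<union> set v'. m < t"
      using d by (auto simp: order_le_less)
    have "x < Max (set (v @ v'))" if "x \<in> set v" for x
    proof -
      have "x \<le> Max (set (v @ v'))" using that by (intro Max_ge) auto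
      moreover have "x \<noteq> Max (set (v @ v'))" using that Step.hyps(6) d by auto
      ultimately show ?thesis by simp
    qed
    then have "\<forall>x\<in>set v. \<exists>z\<in>set v'. x < z" using Step.hyps(6) by blast
    then have "valley_dominated w"
      using Step.IH valley_dominated_split_min[OF min] w by blast
    then show ?case using Step.hyps(1) by blast
  qed (auto simp: word_def valley_dominated_def Cons_eq_append_conv)
next
  assume "word w \<and> valley_dominated w"
  then show "andreI w"
  proof (induction w rule: length_induct)
    case (1 w)
    show ?case
    proof (cases "length w \<ge> 2")
      case False
      then have "w = [] \<or> (\<exists>x. w = [x])" by (cases w; cases "tl w") auto
      then show ?thesis using 1 by (auto simp: word_def intro: andreI.intros)
    next
      case True
      then have "w \<noteq> []" by auto
      then have "Min (set w) \<in> set w" by simp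
      then obtain v v' where w: "w = v @ Min (set w) # v'" by (meson split_list)
      define m where "m = Min (set w)"
      have w': "w = v @ m # v'" unfolding m_def by (fact w)
      have d: "distinct (v @ m # v')" using 1 w' by (auto simp: word_def)
      have "m \<le> t" if "t \<in> set v \<union> set v'" for t
        unfolding m_def using that w' by (intro Min_le) auto
      then have min: "\<forall>t\<in>set v \<union> set v'. m < t"
        using d by (auto simp: order_le_less)
      have R: "valley_dominated v" "valley_dominated v'" "\<forall>x\<in>set v. \<exists>z\<in>set v'. x < z"
        using 1 w' valley_dominated_split_min[OF min] by auto
      have "andreI v" "andreI v'" using 1 w' R by (auto simp: word_def)
      moreover have "Max (set (v @ v')) \<in> set v'"
      proof -
        have "Max (set (v @ v')) \<in> set (v @ v')"
          using True w' by (intro Max_in) auto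
        moreover have "Max (set (v @ v')) \<notin> set v"
        proof
          assume "Max (set (v @ v')) \<in> set v"
          then obtain z where "z \<in> set v'" "Max (set (v @ v')) < z" using R by blast
          moreover from this have "z \<le> Max (set (v @ v'))" by (intro Max_ge) auto
          ultimately show False by (meson not_le)
        qed
        ultimately show ?thesis by auto
      qed
      ultimately show ?thesis using andreI.Step[OF _ True w] 1 by blast
    qed
  qed
qed

section \<open>Invariance under order-preserving relabelling\<close>

lemma map_eq_append_Cons:
  assumes "map f w = b @ y # c"
  obtains b' y' c' where "w = b' @ y' # c'" "b = map f b'" "y = f y'" "c = map f c'"
  using assms by (auto simp: map_eq_append_conv)

lemma valley_dominated_map_imp:
  assumes mono: "strict_mono_on (set w) f" and vd: "valley_dominated w"
  shows "valley_dominated (map f w)"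
  unfolding valley_dominated_def
proof (intro allI impI)
  fix a x b y c
  assume "map f w = a @ x # b @ y # c" and gt: "\<forall>t\<in>set (x # b). y < t"
  then obtain a' x' b' y' c' where w: "w = a' @ x' # b' @ y' # c'"
    and m: "x = f x'" "b = map f b'" "y = f y'" "c = map f c'"
    by (fastforce simp: map_eq_append_conv append_eq_map_conv Cons_eq_map_conv)
  have iff: "f s < f t \<longleftrightarrow> s < t" if "s \<in> set w" "t \<in> set w" for s t
    using mono that by (metis strict_mono_on_less)
  \<comment> \<open>Runs are defined by comparisons of letters only, so \<open>f\<close> carries the
    run after \<open>y'\<close> to the run after \<open>y\<close>.\<close>
  have "takeWhile (\<lambda>t. f y' < f t) c' = takeWhile (\<lambda>t. y' < t) c'"
    by (rule takeWhile_cong) (use w iff in auto)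
  then have tw: "takeWhile (\<lambda>t. y < t) c = map f (takeWhile (\<lambda>t. y' < t) c')"
    by (simp add: m takeWhile_map comp_def)
  have "y' < x'" "\<forall>t\<in>set b'. y' < t" using gt m iff w by auto
  then obtain z where z: "z \<in> set (takeWhile (\<lambda>t. y' < t) c')" "x' < z"
    using valley_dominatedD[of a' x' b' y' c'] vd w by blast
  then have "z \<in> set w" using w set_takeWhileD by fastforce
  then show "\<exists>z\<in>set (takeWhile (\<lambda>t. y < t) c). x < z"
    using z(1) iff[of x' z] z(2) unfolding tw m(1) by (auto simp: w)
qed

section \<open>The last letter, \<open>grn\<close> and \<open>spi\<close>\<close>

lemma last_eq_Max_if_valley_dominated:
  assumes "valley_dominated w" "w \<noteq> []" "distinct w"
  shows "last w = Max (set w)"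
proof (rule ccontr)
  assume ne: "last w \<noteq> Max (set w)"
  define M where "M = Max (set w)"
  have "M \<in> set w" using assms by (simp add: M_def)
  then obtain a r where w: "w = a @ M # r" by (meson split_list)
  have le: "t \<le> M" if "t \<in> set w" for t using that by (simp add: M_def)
  have "r \<noteq> []" using ne w M_def by (metis last_snoc)
  \<comment> \<open>With \<open>y\<close> the smallest letter after \<open>M\<close>, the factor
    from \<open>M\<close> up to just before \<open>y\<close> lies above \<open>y\<close>. The local
    condition then asks for a letter larger than the maximum \<open>M\<close>.\<close>
  define y where "y = Min (set r)"
  have "y \<in> set r" using \<open>r \<noteq> []\<close> by (simp add: y_def)
  then obtain b c where r: "r = b @ y # c" and nb: "y \<notin> set b" by (meson split_list_first)
  have y: "y \<le> t" if "t \<in> set r" for t using that by (simp add: y_def)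
  have 1: "y < M" using le[of y] w r assms(3) by (auto simp: order_le_less)
  have 2: "\<forall>t\<in>set b. y < t" using nb y r by (fastforce simp: order_le_less)
  have "valley_dominated (a @ M # b @ y # c)" using assms(1) w r by simp
  from valley_dominatedD[OF this 1 2]
  obtain z where z: "z \<in> set (takeWhile (\<lambda>t. y < t) c)" "M < z" by blast
  then have "z \<in> set w" using w r by (auto dest: set_takeWhileD)
  then show False using le z(2) by (meson not_le)
qed

text \<open>The right neighbour of the final maximum is the conventional 0, which leaves
  \<open>x\<close> as the larger neighbour.\<close>

lemma grn_snoc_snoc:
  assumes d: "distinct (a @ [x, y])" and y: "y = Max (set (a @ [x, y]))"
  shows "grn (a @ [x, y]) = x"
proof -
  let ?w = "a @ [x, y]"
  have "(THE i. i \<in> {1..length ?w} \<and> letter ?w i = Max (set ?w)) = length ?w"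
  proof (rule the_equality)
    show "length ?w \<in> {1..length ?w} \<and> letter ?w (length ?w) = Max (set ?w)"
      using y by (simp add: letter_def nth_append)
  next
    fix i assume i: "i \<in> {1..length ?w} \<and> letter ?w i = Max (set ?w)"
    then have "?w ! (i - 1) = Max (set ?w)" by (auto simp: letter_def)
    also have "\<dots> = ?w ! (length ?w - 1)" using y by (simp add: nth_append)
    finally have "?w ! (i - 1) = ?w ! (length ?w - 1)" .
    moreover have "i - 1 < length ?w" "length ?w - 1 < length ?w" using i by auto
    ultimately have "i - 1 = length ?w - 1" using d nth_eq_iff_index_eq by blast
    then show "i = length ?w" using i by auto
  qed
  then show ?thesis by (simp add: grn_def letter_def nth_append)
qed

text \<open>The index sought is \<open>length p\<close>: after a smaller index the next letter is
  still in \<open>p\<close>, hence not below \<open>hd p\<close>, and a larger index admits a letter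
  below \<open>hd p\<close> among the first ones. If \<open>q = []\<close>, the next letter is the
  conventional 0, and \<open>0 < hd p\<close> makes it smaller than \<open>hd p\<close>.\<close>

lemma spi_append_eq_last:
  assumes "p \<noteq> []" "\<forall>t\<in>set p. hd p \<le> t" "0 < hd p" "q = [] \<or> hd q < hd p"
  shows "spi (p @ q) = last p"
proof -
  let ?w = "p @ q"
  have l1: "letter ?w 1 = hd p" using assms(1)
    by (cases p) (auto simp: letter_def)
  have ll: "letter ?w i = p ! (i - 1)" if "1 \<le> i" "i \<le> length p" for i
    using that by (auto simp: letter_def nth_append)
  have lq: "letter ?w (length p + 1) < hd p"
    using assms by (cases q) (auto simp: letter_def nth_append)
  have ge: "hd p \<le> letter ?w i" if "1 \<le> i" "i \<le> length p" for i
    using that assms(2) ll[OF that] by simp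
  have "(THE i. i \<in> {1..length ?w} \<and> (\<forall>j\<in>{1..i}. letter ?w 1 \<le> letter ?w j) \<and>
      letter ?w 1 > letter ?w (i + 1)) = length p"
  proof (rule the_equality)
    have "1 \<le> length p" using assms(1) by (simp add: Suc_le_eq)
    then show "length p \<in> {1..length ?w} \<and> (\<forall>j\<in>{1..length p}. letter ?w 1 \<le> letter ?w j) \<and>
      letter ?w 1 > letter ?w (length p + 1)"
      using lq ge unfolding l1 by auto
  next
    fix i assume i: "i \<in> {1..length ?w} \<and> (\<forall>j\<in>{1..i}. letter ?w 1 \<le> letter ?w j) \<and>
      letter ?w 1 > letter ?w (i + 1)"
    have "\<not> i < length p" using i ge[of "i + 1"] unfolding l1 by auto
    moreover have "\<not> length p < i"
    proof
      assume "length p < i"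
      then have "length p + 1 \<in> {1..i}" by auto
      then show False using i lq unfolding l1 by (meson not_le)
    qed
    ultimately show "i = length p" by simp
  qed
  then show ?thesis using assms(1) ll[of "length p"]
    by (simp add: spi_def last_conv_nth Suc_le_eq)
qed

section \<open>\<open>phi\<close> produces tight Andre I words\<close>

abbreviation raise_from :: "nat \<Rightarrow> nat \<Rightarrow> nat" where
  "raise_from s x \<equiv> if x < s then x else x + 1"

text \<open>The first factor \<open>v @ [s]\<close> is the longest prefix whose letters are at least the first letter.\<close>

lemma spi_factorization:
  assumes "word w" "valley_dominated w" "w \<noteq> []"
  obtains v q s where "w = v @ s # q" "spi w = s" "\<forall>t\<in>set v. t < s"
    "\<forall>t\<in>set (v @ [s]). hd w \<le> t" "q = [] \<or> hd q < hd w"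
proof -
  define p where "p = takeWhile (\<lambda>t. hd w \<le> t) w"
  define q where "q = dropWhile (\<lambda>t. hd w \<le> t) w"
  have w: "w = p @ q" by (simp add: p_def q_def)
  have "p \<noteq> []" using assms(3) by (cases w) (auto simp: p_def)
  have hdp: "hd p = hd w" using w \<open>p \<noteq> []\<close> by (metis hd_append2)
  have ge: "\<forall>t\<in>set p. hd w \<le> t" unfolding p_def by (meson set_takeWhileD)
  have hq: "q = [] \<or> hd q < hd w" unfolding q_def by (metis hd_dropWhile not_le)
  have "0 < hd w" using assms by (simp add: word_def)
  then have spi: "spi w = last p" using spi_append_eq_last[of p q] \<open>p \<noteq> []\<close> ge hq hdp w by metis
  define v s where "v = butlast p" and "s = last p"
  have p: "p = v @ [s]" using \<open>p \<noteq> []\<close> by (simp add: v_def s_def)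
  have d: "distinct (v @ s # q)" using assms(1) w p by (simp add: word_def)
  have lt: "\<forall>t\<in>set v. t < s"
  proof (rule ccontr)
    assume "\<not> (\<forall>t\<in>set v. t < s)"
    then have "\<exists>t\<in>set v. \<not> t < s" by blast
    then obtain a x b where v: "v = a @ x # b" and x: "\<not> x < s" and b: "\<forall>t\<in>set b. \<not> \<not> t < s"
      by (rule split_list_last_propE)
    \<comment> \<open>Here \<open>x\<close> is the last letter of \<open>v\<close> not below
      \<open>s\<close>. The run after the minimum \<open>y\<close> of the letters from there to
      \<open>s\<close> must contain a letter above \<open>x\<close>. But this run cannot enter
      \<open>q\<close>, whose first letter is below \<open>hd w\<close> and so below
      \<open>y\<close>, and the letters between \<open>x\<close> and \<open>q\<close> are at most
      \<open>s < x\<close>.\<close>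
    define y where "y = Min (set (b @ [s]))"
    have "y \<in> set (b @ [s])" unfolding y_def by (intro Min_in) auto
    then obtain b1 b2 where bs: "b @ [s] = b1 @ y # b2" and nb: "y \<notin> set b1"
      by (meson split_list_first)
    have y: "y \<le> t" if "t \<in> set (b @ [s])" for t unfolding y_def using that by (intro Min_le) auto
    have sub: "set b1 \<subseteq> set (b @ [s])" "set b2 \<subseteq> set (b @ [s])" using bs by auto
    have "s < x" using x d v by auto
    then have yx: "y < x" using y[of s] by auto
    have yb: "\<forall>t\<in>set b1. y < t" using nb y sub by (metis le_neq_implies_less subsetD)
    have "w = a @ x # (b @ [s]) @ q" using w p v by simp
    also have "\<dots> = a @ x # b1 @ y # (b2 @ q)" using bs by simp
    finally obtain z where z: "z \<in> set (takeWhile (\<lambda>t. y < t) (b2 @ q))" "x < z"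
      using valley_dominatedD[of a x b1 y "b2 @ q"] assms(2) yx yb by metis
    have "hd w \<le> y" using \<open>y \<in> set (b @ [s])\<close> ge p v by auto
    then have "z \<in> set b2" using z(1) hq takeWhile_append_subset[of q "\<lambda>t. y < t" b2] by auto
    then have "z \<le> s" using sub b by fastforce
    then show False using z(2) \<open>s < x\<close> by simp
  qed
  show ?thesis
  proof
    show "w = v @ s # q" using w p by simp
    show "spi w = s" using spi s_def by simp
    show "\<forall>t\<in>set (v @ [s]). hd w \<le> t" using ge p by simp
  qed (use lt hq in auto)
qed

text \<open>Relabelling preserves the local condition, so only factors starting with the prepended
  \<open>s\<close> need checking, against letters \<open>y < s\<close>, which relabelling fixes.
  Tightness reads off \<open>spi_factorization\<close>: \<open>v\<close> stays fixed, the old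
  \<open>s\<close> becomes \<open>s + 1\<close>, and the next letter, if any, is below all earlier
  ones.\<close>

lemma phi_tight_valley_dominated:
  assumes "word w" "valley_dominated w" "w \<noteq> []"
  shows "valley_dominated (phi w)" "tight (phi w)" "spi w \<in> set w"
proof -
  obtain v q s where w: "w = v @ s # q" and spi: "spi w = s" and lt: "\<forall>t\<in>set v. t < s"
    and ge: "\<forall>t\<in>set (v @ [s]). hd w \<le> t" and hq: "q = [] \<or> hd q < hd w"
    using spi_factorization[OF assms] by metis
  let ?f = "raise_from s"
  have phi: "phi w = s # map ?f w" by (simp add: phi_def spi)
  show "spi w \<in> set w" using w spi by simp
  have "strict_mono_on (set w) ?f" by (auto simp: strict_mono_on_def)
  then have vd: "valley_dominated (map ?f w)" using valley_dominated_map_imp assms(2) by blast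
  have "\<exists>z\<in>set (takeWhile (\<lambda>t. y < t) c). s < z"
    if eq: "map ?f w = b @ y # c" and "\<forall>t\<in>set b. y < t" "y < s" for b y c
  proof -
    obtain b0 y0 c0 where wb: "w = b0 @ y0 # c0" and m: "b = map ?f b0" "y = ?f y0" "c = map ?f c0"
      using eq by (rule map_eq_append_Cons)
    have y0: "y0 = y" using m(2) that(3) by (auto split: if_splits)
    have b0: "\<forall>t\<in>set b0. y < t"
    proof
      fix t assume "t \<in> set b0"
      then have "y < ?f t" using that(2) m(1) by auto
      then show "y < t" using that(3) by (auto split: if_splits)
    qed
    have "(\<lambda>t. y < ?f t) = (\<lambda>t. y < t)" using that(3) by (auto simp: fun_eq_iff)
    then have tw: "takeWhile (\<lambda>t. y < t) c = map ?f (takeWhile (\<lambda>t. y < t) c0)"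
      by (simp add: m takeWhile_map comp_def)
    \<comment> \<open>A weak inequality suffices, because relabelling raises every letter
      \<open>z \<ge> s\<close> to at least \<open>s + 1\<close>.\<close>
    have "\<exists>z\<in>set (takeWhile (\<lambda>t. y < t) c0). s \<le> z"
    proof -
      have "b0 @ y # c0 = v @ s # q" using wb y0 w by simp
      then show ?thesis
      proof (cases rule: append_Cons_eq_append_Cons_cases)
        case (left c')
        \<comment> \<open>For \<open>y\<close> before the old \<open>s\<close>, all letters up to
          \<open>s\<close> are at least \<open>hd w\<close>, which forces \<open>y\<close> to be the
          first letter. The run after \<open>y\<close> therefore reaches \<open>s\<close>
          itself.\<close>
        have "b0 = []"
        proof (rule ccontr)
          assume "b0 \<noteq> []"
          then have "hd w \<in> set b0" using wb by (metis hd_append2 hd_in_set)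
          then have "y < hd w" using b0 by simp
          then show False using ge left by auto
        qed
        then have "hd w = y" using wb y0 by simp
        have "\<forall>t\<in>set c'. y < t"
        proof
          fix t assume t: "t \<in> set c'"
          have "y \<noteq> t" using t assms(1) w left by (auto simp: word_def)
          moreover have "y \<le> t" using ge t left \<open>hd w = y\<close> by auto
          ultimately show "y < t" by simp
        qed
        then show ?thesis using left that(3) by auto
      next
        case same
        then show ?thesis using that(3) by simp
      next
        case (right q')
        \<comment> \<open>For \<open>y\<close> after the old \<open>s\<close>, the condition is that
          of \<open>w\<close> for the factor starting at the old \<open>s\<close>.\<close>
        have "valley_dominated (v @ s # q' @ y # c0)" using assms(2) w right by simp
        then show ?thesis using valley_dominatedD[of v s q' y c0] b0 right that(3)
          by (metis UnCI less_imp_le list.set_intros(2) set_append)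
      qed
    qed
    then obtain z where "z \<in> set (takeWhile (\<lambda>t. y < t) c0)" "s < ?f z" by fastforce
    then show ?thesis unfolding tw set_map by blast
  qed
  then show "valley_dominated (phi w)" using vd unfolding phi valley_dominated_Cons by blast
  have mv: "map ?f v = v" using lt by (simp add: map_idI)
  have "phi w = s # v @ (s + 1) # map ?f q"
    unfolding phi using mv by (simp add: w)
  moreover have "map ?f q \<noteq> [] \<and> (\<forall>x\<in>set (s # v @ [s + 1]). hd (map ?f q) < x) \<or> map ?f q = []"
  proof (cases "q = []")
    case False
    then have "hd q < hd w" "hd w \<le> s" using hq ge by auto
    then have "hd (map ?f q) = hd q" using False by (simp add: hd_map)
    moreover have "hd q < x" if "x \<in> set (s # v @ [s + 1])" for x
      using \<open>hd q < hd w\<close> \<open>hd w \<le> s\<close> ge that by (auto intro: less_le_trans)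
    ultimately show ?thesis using False by simp
  qed simp
  ultimately show "tight (phi w)" unfolding tight_def using lt by blast
qed

section \<open>Bijectivity onto the tight permutations\<close>

lemma raise_from_image:
  assumes "s \<in> {1..k}"
  shows "insert s (raise_from s ` {1..k}) = {1..k + 1}"
proof -
  have "x \<in> insert s (raise_from s ` {1..k})" if "x \<in> {1..k + 1}" for x
  proof (cases "x < s")
    case True
    then have "x = raise_from s x" "x \<in> {1..k}" using that assms by auto
    then show ?thesis by blast
  next
    case False
    show ?thesis
    proof (cases "x = s")
      case False
      then have "x = raise_from s (x - 1)" "x - 1 \<in> {1..k}" using that assms \<open>\<not> x < s\<close> by auto
      then show ?thesis by blast
    qed simp
  qed
  moreover have "insert s (raise_from s ` {1..k}) \<subseteq> {1..k + 1}" using assms by auto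
  ultimately show ?thesis by blast
qed

lemma And_I_iff:
  "w \<in> And_I n \<longleftrightarrow> distinct w \<and> set w = {1..n} \<and> valley_dominated w"
  by (auto simp: And_I_def permutations_of_set_def andreI_iff_valley_dominated word_def)

lemma And_I_nonempty_word:
  assumes "w \<in> And_I n" "n \<ge> 1"
  shows "word w" "valley_dominated w" "w \<noteq> []"
  using assms by (auto simp: And_I_iff word_def)

lemma phi_in_Tight:
  assumes "w \<in> And_I n" "n \<ge> 1"
  shows "phi w \<in> Tight (n + 1)"
proof -
  note W = phi_tight_valley_dominated[OF And_I_nonempty_word[OF assms]]
  have w: "distinct w" "set w = {1..n}" using assms by (auto simp: And_I_iff)
  have "inj (raise_from (spi w))" by (rule injI) (auto split: if_splits)
  then have "distinct (map (raise_from (spi w)) w)"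
    using w by (auto simp: distinct_map intro: inj_on_subset)
  then have "distinct (phi w)" by (auto simp: phi_def split: if_splits)
  moreover have "set (phi w) = {1..n + 1}"
    using raise_from_image[of "spi w" n] W(3) w by (simp add: phi_def)
  ultimately show ?thesis using W by (simp add: Tight_def And_I_iff)
qed

text \<open>The first letter of \<open>phi w\<close> records \<open>spi w\<close>, hence determines
  the injective relabelling to undo.\<close>

lemma inj_phi: "inj phi"
proof (rule injI)
  fix w w' assume eq: "phi w = phi w'"
  then have s: "spi w = spi w'" by (simp add: phi_def)
  have "inj (raise_from (spi w))" by (rule injI) (auto split: if_splits)
  moreover have "map (raise_from (spi w)) w = map (raise_from (spi w)) w'"
    using eq s by (simp add: phi_def)
  ultimately show "w = w'" using inj_map_eq_map[of "raise_from (spi w)" w w'] by blast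
qed

lemma Tight_subset_phi_image:
  assumes u: "u \<in> Tight (n + 1)"
  shows "u \<in> phi ` And_I n"
proof -
  have "tight u" using u by (simp add: Tight_def)
  then obtain m v v' where um: "u = m # v @ (m + 1) # v'"
    and vm': "v = [] \<or> (\<forall>x\<in>set v. x < m)"
    and v': "v' = [] \<or> (\<forall>x\<in>set (m # v @ [m + 1]). hd v' < x)"
    unfolding tight_def by blast
  from vm' have vm: "\<forall>x\<in>set v. x < m" by auto
  have d: "distinct u" and su: "set u = {1..n + 1}" and vd: "valley_dominated u"
    using u by (auto simp: Tight_def And_I_iff)
  \<comment> \<open>The preimage is found by deleting the first letter \<open>m\<close> and closing
    the gap; \<open>g\<close> inverts \<open>raise_from m\<close> away from
    \<open>m\<close>.\<close>
  define g where "g x = (if x \<le> m then x else x - 1)" for x :: nat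
  define t where "t = v @ (m + 1) # v'"
  define w where "w = map g t"
  have ut: "u = m # t" using um t_def by simp
  have mt: "m \<notin> set t" using d ut by simp
  have fg: "raise_from m (g x) = x" if "x \<noteq> m" for x using that by (auto simp: g_def)
  \<comment> \<open>The only values that \<open>g\<close> identifies are \<open>m\<close> and
    \<open>m + 1\<close>, and \<open>m\<close> does not occur in \<open>t\<close>.\<close>
  have mono: "strict_mono_on (set t) g"
  proof (rule strict_mono_onI)
    fix x y assume "x \<in> set t" "y \<in> set t" "x < y"
    then show "g x < g y" using mt by (cases "y \<le> m"; cases "x = m") (auto simp: g_def)
  qed
  have "valley_dominated t" using vd ut valley_dominated_suffix[of "[m]" t] by simp
  then have wvd: "valley_dominated w" unfolding w_def using mono valley_dominated_map_imp by blast
  have "inj_on g (set t)" using mono by (rule strict_mono_on_imp_inj_on)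
  then have wd: "distinct w" unfolding w_def using d ut by (simp add: distinct_map)
  have "m \<in> set u" "m + 1 \<in> set u" using um by auto
  then have m: "m \<in> {1..n}" using su by auto
  have "m \<noteq> x \<Longrightarrow> x \<in> {1..n + 1} \<Longrightarrow> g x \<in> {1..n}" for x using m by (auto simp: g_def)
  then have sub: "set w \<subseteq> {1..n}" unfolding w_def using su ut mt by fastforce
  have "length u = n + 1" using d su distinct_card[OF d] by simp
  then have "card (set w) = n" using distinct_card[OF wd] ut by (simp add: w_def)
  then have sw: "set w = {1..n}" using sub card_subset_eq[of "{1..n}" "set w"] by simp
  have wA: "w \<in> And_I n" using wd sw wvd by (simp add: And_I_iff)
  have gv: "map g v = v" using vm by (intro map_idI) (auto simp: g_def)
  have wsplit: "w = (v @ [m]) @ map g v'" using gv by (simp add: w_def t_def g_def)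
  \<comment> \<open>When \<open>v\<close> starts with \<open>y < m\<close>, the local condition for
    the one-letter factor \<open>m\<close> puts a letter above \<open>m\<close> into the run after
    \<open>y\<close>. As \<open>v\<close> has only letters below \<open>m\<close>, this run extends
    past \<open>v\<close>, so the rest of \<open>v\<close> exceeds \<open>y\<close>.\<close>
  have hp: "\<forall>x\<in>set (v @ [m]). hd (v @ [m]) \<le> x"
  proof (cases v)
    case (Cons y c)
    have "valley_dominated ([] @ m # [] @ y # (c @ (m + 1) # v'))" using vd um Cons by simp
    from valley_dominatedD[OF this]
    obtain z where z: "z \<in> set (takeWhile (\<lambda>t. y < t) (c @ (m + 1) # v'))" "m < z"
      using vm Cons by auto
    have "\<forall>x\<in>set c. y < x"
    proof (rule ccontr)
      assume "\<not> (\<forall>x\<in>set c. y < x)"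
      then have "takeWhile (\<lambda>t. y < t) (c @ (m + 1) # v') = takeWhile (\<lambda>t. y < t) c"
        by (auto simp: takeWhile_append1)
      then have "z \<in> set c" using z(1) by (metis set_takeWhileD)
      then show False using vm Cons z(2) by auto
    qed
    then show ?thesis using vm Cons by (auto intro: less_imp_le)
  qed simp
  \<comment> \<open>The first letter of \<open>v'\<close> is below \<open>m\<close>, so
    \<open>g\<close> fixes it, and it ends the prefix \<open>v @ [m]\<close> as
    \<open>spi_append_eq_last\<close> requires.\<close>
  have "map g v' = [] \<or> hd (map g v') < hd (v @ [m])"
  proof (cases "v' = []")
    case False
    then have "hd v' < m" "hd v' < hd (v @ [m])" using v' by (cases v; auto)+
    then show ?thesis using False by (simp add: hd_map g_def)
  qed simp
  moreover have "hd (v @ [m]) \<in> set u" using um by (cases v) auto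
  then have "0 < hd (v @ [m])" using su by auto
  ultimately have "spi w = m" using hp spi_append_eq_last[of "v @ [m]" "map g v'"] wsplit by simp
  moreover have "map (raise_from m) w = t"
    unfolding w_def map_map by (rule map_idI) (use fg mt in force)
  ultimately have "phi w = u" using ut by (simp add: phi_def)
  then show ?thesis using wA by blast
qed

text \<open>Both \<open>w\<close> and \<open>phi w\<close> end with their maximum, so
  \<open>grn\<close> is the penultimate letter of each. As \<open>w\<close> has at least two
  letters, the penultimate letter of \<open>phi w\<close> is the relabelled one of \<open>w\<close>,
  not the prepended letter.\<close>

lemma grn_phi:
  assumes w: "w \<in> And_I n" and "n \<ge> 2"
  shows "grn (phi w) = raise_from (spi w) (grn w)"
proof -
  have n: "n \<ge> 1" using assms by simp
  note W = And_I_nonempty_word[OF w n]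
  have d: "distinct w" "set w = {1..n}" using w by (auto simp: And_I_iff)
  then have "length w \<ge> 2" using distinct_card[OF d(1)] assms(2) by simp
  then obtain a x y where wxy: "w = a @ [x, y]"
    by (cases w rule: rev_cases; cases "butlast w" rule: rev_cases) auto
  have "y = Max (set w)" using last_eq_Max_if_valley_dominated[OF W(2,3) d(1)] wxy by simp
  then have gw: "grn w = x" using grn_snoc_snoc[of a x y] d wxy by simp
  let ?f = "raise_from (spi w)"
  have ph: "phi w = (spi w # map ?f a) @ [?f x, ?f y]" by (simp add: phi_def wxy)
  have P: "phi w \<in> And_I (n + 1)" using phi_in_Tight[OF w n] by (simp add: Tight_def)
  then have dp: "distinct (phi w)" "valley_dominated (phi w)" by (auto simp: And_I_iff)
  have "last (phi w) = Max (set (phi w))"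
    by (rule last_eq_Max_if_valley_dominated) (use dp in \<open>auto simp: phi_def\<close>)
  then have "?f y = Max (set (phi w))" using ph by simp
  then show ?thesis using grn_snoc_snoc[of "spi w # map ?f a" "?f x" "?f y"] dp(1) gw
    unfolding ph[symmetric] by simp
qed

theorem theorem6p3:
  fixes n :: nat
  assumes "n \<ge> 3"
  shows "bij_betw phi (And_I (n - 1)) (Tight n) \<and>
         (\<forall>w\<in>And_I (n - 1).
            spi w = F (phi w) \<and>
            (spi w > grn w \<longrightarrow> grn (phi w) = grn w) \<and>
            (spi w < grn w \<longrightarrow> grn (phi w) = grn w + 1))"
proof -
  have n: "n - 1 + 1 = n" "n - 1 \<ge> 1" "n - 1 \<ge> 2" using assms by auto
  have "phi ` And_I (n - 1) = Tight n"
    using phi_in_Tight[OF _ n(2)] Tight_subset_phi_image[of _ "n - 1"] n(1) by auto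
  then have "bij_betw phi (And_I (n - 1)) (Tight n)"
    using inj_phi by (simp add: bij_betw_def inj_on_subset[of phi UNIV])
  moreover have "spi w = F (phi w)" for w
    by (simp add: F_def letter_def phi_def)
  ultimately show ?thesis using grn_phi[OF _ n(3)] by simp
qed

end
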